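(* Let $R$ be a ring and let $n \ge 2$ be a natural number. The following statements are equivalent: (1) $R$ is strongly $n$-nil-clean. (2) For each $a \in R$ one can write $a = ev + b$, where $e^2 = e \in R$, $v \in U(R)$ with $v^n = v$, and $b \in \mathrm{Nil}(R)$, with $ab = ba$ and $ev = ve$. (3) For each $a \in R$ one can write $a = ev + b$, where $e^2 = e \in R$, $v \in U(R)$ with $v^n = v$, and $b \in \mathrm{Nil}(R)$, with $ab = ba$ and $ve = eve$. (4) $a - a^n$ is nilpotent for every $a \in R$. (5) For each $a \in R$, $a^{n-1}$ is a strongly nil-clean element of $R$. (6) $R$ is strongly $\pi$-regular and an $(n-1)$-UU ring.
   Context: Rings are associative with identity, not necessarily commutative. $U(R)$ is the group of units and $\mathrm{Nil}(R)$ the set of nilpotent elements of $R$. An element $r \in R$ is $n$-potent ($n\ge 2$) if $r^n = r$. A ring $R$ is strongly $n$-nil-clean if every element of $R$ is a sum of an $n$-potent and a nilpotent that commute with each other. An element of $R$ is strongly nil-clean if it is a sum of an idempotent and a nilpotent that commute with each other. For a positive integer $k$, $R$ is a $k$-UU ring if $u^k \in 1 + \mathrm{Nil}(R)$ for every $u \in U(R)$. $R$ is strongly $\pi$-regular if for each $a \in R$ there is a positive integer $k$ with $a^k \in a^{k+1}R \cap R a^{k+1}$. *)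

theory Defs
  imports "HOL-Algebra.Algebra"
begin

text \<open>
  Rings are the (associative, unital, not necessarily commutative, possibly zero) rings of the
  locale \<^locale>\<open>ring\<close>; the group of units of \<open>R\<close> is \<^term>\<open>Units R\<close>.
\<close>

definition nilpotents :: "('a, 'm) ring_scheme \<Rightarrow> 'a set" where
  "nilpotents R = {x \<in> carrier R. \<exists>k::nat. k > 0 \<and> x [^]\<^bsub>R\<^esub> k = \<zero>\<^bsub>R\<^esub>}"

definition idempotents :: "('a, 'm) ring_scheme \<Rightarrow> 'a set" where
  "idempotents R = {e \<in> carrier R. e \<otimes>\<^bsub>R\<^esub> e = e}"

text \<open>Only meaningful for \<open>n \<ge> 2\<close>.\<close>

definition potents :: "('a, 'm) ring_scheme \<Rightarrow> nat \<Rightarrow> 'a set" where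
  "potents R n = {x \<in> carrier R. x [^]\<^bsub>R\<^esub> n = x}"

definition strongly_n_nil_clean :: "('a, 'm) ring_scheme \<Rightarrow> nat \<Rightarrow> bool" where
  "strongly_n_nil_clean R n \<longleftrightarrow>
     (\<forall>a \<in> carrier R. \<exists>p \<in> potents R n. \<exists>b \<in> nilpotents R.
        a = p \<oplus>\<^bsub>R\<^esub> b \<and> p \<otimes>\<^bsub>R\<^esub> b = b \<otimes>\<^bsub>R\<^esub> p)"

definition strongly_nil_clean_elt :: "('a, 'm) ring_scheme \<Rightarrow> 'a \<Rightarrow> bool" where
  "strongly_nil_clean_elt R a \<longleftrightarrow>
     (\<exists>e \<in> idempotents R. \<exists>b \<in> nilpotents R.
        a = e \<oplus>\<^bsub>R\<^esub> b \<and> e \<otimes>\<^bsub>R\<^esub> b = b \<otimes>\<^bsub>R\<^esub> e)"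

text \<open>
  Only meaningful for \<open>k > 0\<close>. The right-hand side is the additive coset \<open>1 + Nil(R)\<close>
  (\<open>nilpotents R\<close> need not be an ideal).
\<close>

definition UU_ring :: "nat \<Rightarrow> ('a, 'm) ring_scheme \<Rightarrow> bool" where
  "UU_ring k R \<longleftrightarrow> (\<forall>u \<in> Units R. u [^]\<^bsub>R\<^esub> k \<in> \<one>\<^bsub>R\<^esub> <+\<^bsub>R\<^esub> nilpotents R)"

text \<open>The multiplicative cosets \<open>x <# carrier R\<close> and \<open>carrier R #> x\<close> are \<open>xR\<close> and \<open>Rx\<close>.\<close>

definition strongly_pi_regular :: "('a, 'm) ring_scheme \<Rightarrow> bool" where
  "strongly_pi_regular R \<longleftrightarrow>
     (\<forall>a \<in> carrier R. \<exists>k::nat. k > 0 \<and>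
        a [^]\<^bsub>R\<^esub> k \<in> (a [^]\<^bsub>R\<^esub> (k + 1) <#\<^bsub>R\<^esub> carrier R) \<inter> (carrier R #>\<^bsub>R\<^esub> a [^]\<^bsub>R\<^esub> (k + 1)))"

end

theory Submission
  imports Defs "HOL-Number_Theory.Residues" "HOL-Computational_Algebra.Polynomial"
begin

text \<open>
  Write \<open>m = n - 1\<close>. The hub of the proof is the nilpotence of \<open>a - a\<^sup>n\<close> for all \<open>a\<close>, and the substantial
  step leads from there to strong \<open>n\<close>-nil-cleanness (\<open>potent_part_exists\<close>). One looks for the potent
  part of \<open>a\<close> among the integer polynomials in \<open>a\<close>, so that it commutes with \<open>a\<close> automatically. Let
  \<open>I\<close> be the ideal of integer polynomials that vanish at \<open>a\<close>. Some power of \<open>X\<^sup>n - X\<close> lies in \<open>I\<close>, and so does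
  some positive integer, because \<open>2 - 2\<^sup>n\<close> is nilpotent in \<open>R\<close>. What remains is a statement on commutative
  rings (\<open>lift_potent\<close>): an element that is \<open>n\<close>-potent modulo the radical of such an ideal \<open>I\<close> is
  congruent, modulo the radical, to one that is \<open>n\<close>-potent modulo \<open>I\<close>. Hensel lifting does not apply
  directly, since \<open>X\<^sup>n - X\<close> may have multiple roots modulo a prime \<open>p\<close> that divides \<open>n - 1\<close>. If \<open>I\<close>
  contains a power of \<open>p\<close>, however, a suitable \<open>p\<close>-power of the element is potent: high \<open>p\<close>-powers erase nilpotent
  differences. The Chinese remainder theorem reduces the general case to this one.

  The other implications are short. An \<open>n\<close>-potent \<open>p\<close> is the product of the idempotent \<open>p\<^sup>m\<close> and the
  unit \<open>p + (1 - p\<^sup>m)\<close>, which yields the two descriptions by idempotents and units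
  (\<open>potent_eq_idempotent_times_unit\<close>); conversely \<open>ve = eve\<close> is enough for \<open>ev\<close> to be \<open>n\<close>-potent
  (\<open>idempotent_times_potent_unit\<close>). If \<open>a = p + b\<close>, then \<open>a\<^sup>m\<close> differs from the idempotent \<open>p\<^sup>m\<close> by a multiple of \<open>b\<close>,
  and conversely a strongly nil-clean \<open>a\<^sup>m\<close> makes \<open>a\<^sup>m (1 - a\<^sup>m)\<close> nilpotent. Expanding a vanishing power of
  \<open>a - a\<^sup>n = a (1 - a\<^sup>m)\<close> shows strong \<open>\<pi>\<close>-regularity, and for a unit \<open>a\<close> the factor \<open>1 - a\<^sup>m\<close> is itself
  nilpotent. Conversely, Fitting's decomposition (\<open>fitting_idempotent\<close>) splits a strongly \<open>\<pi>\<close>-regular element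
  into a nilpotent part and a part that extends to a unit, to which the \<open>m\<close>-UU condition applies.
\<close>

section \<open>Binomial coefficients of prime power order\<close>

text \<open>
  Absorption gives \<open>i * (P choose i) = P * ((P - 1) choose (i - 1))\<close> for \<open>P = p ^ (k + s)\<close>, and fewer than
  \<open>s\<close> of the factors \<open>p\<close> of \<open>P\<close> can be absorbed by \<open>i\<close>. The case \<open>k = 0\<close> is what makes the
  Frobenius map additive modulo \<open>p\<close>; large \<open>k\<close> makes a \<open>p\<close>-power insensitive to nilpotent
  perturbations when \<open>p ^ k\<close> vanishes.
\<close>

lemma prime_power_dvd_binomial:
  fixes p :: nat
  assumes p: "Factorial_Ring.prime p" and i: "0 < i" "i < p ^ s"
  shows "p ^ Suc k dvd (p ^ (k + s) choose i)"
proof -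
  have "p ^ (k + s) dvd p ^ (k + s) * ((p ^ (k + s) - 1) choose (i - 1))"
    by simp
  also have "\<dots> = i * (p ^ (k + s) choose i)"
    using times_binomial_minus1_eq[OF i(1), of "p ^ (k + s)"] by simp
  finally have "p ^ (k + s) dvd i * (p ^ (k + s) choose i)" .
  moreover have "\<not> p ^ s dvd i"
    using i by (meson dvd_imp_le not_le)
  ultimately show ?thesis
    using prime_elem_power_dvd_cases[of p "k + s" i "p ^ (k + s) choose i" s "Suc k"] p
    by auto
qed

section \<open>Ideals and radicals in commutative rings\<close>

locale comm_ideal =
  fixes I :: "'a :: comm_ring_1 set"
  assumes zero_mem: "0 \<in> I"
    and add_mem: "x \<in> I \<Longrightarrow> y \<in> I \<Longrightarrow> x + y \<in> I"
    and mult_mem: "x \<in> I \<Longrightarrow> r * x \<in> I"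
begin

definition radical :: "'a set" where
  "radical = {x. \<exists>k. x ^ k \<in> I}"

lemma mult_mem': "x \<in> I \<Longrightarrow> x * r \<in> I"
  using mult_mem[of x r] by (simp add: mult.commute)

lemma diff_mem: "x \<in> I \<Longrightarrow> y \<in> I \<Longrightarrow> x - y \<in> I"
  using add_mem[of x "- 1 * y"] mult_mem[of y "- 1"] by simp

lemma sum_mem: "(\<And>i. i \<in> A \<Longrightarrow> f i \<in> I) \<Longrightarrow> sum f A \<in> I"
  by (induction A rule: infinite_finite_induct) (auto intro: zero_mem add_mem)

lemma power_mem: "x ^ k \<in> I \<Longrightarrow> k \<le> l \<Longrightarrow> x ^ l \<in> I"
  using mult_mem[of "x ^ k" "x ^ (l - k)"] by (simp flip: power_add)

lemma of_nat_mem: "of_nat a \<in> I \<Longrightarrow> a dvd b \<Longrightarrow> of_nat b \<in> I"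
  by (auto elim!: dvdE intro: mult_mem')

lemma subset_radical: "I \<subseteq> radical"
  unfolding radical_def by (auto intro: exI[of _ 1])

lemma radical_root: "x ^ k \<in> radical \<Longrightarrow> x \<in> radical"
  by (auto simp: radical_def simp flip: power_mult)

lemma comm_ideal_radical: "comm_ideal radical"
proof
  show "0 \<in> radical"
    using zero_mem subset_radical by blast
next
  fix x y assume "x \<in> radical" "y \<in> radical"
  then obtain i j where i: "x ^ i \<in> I" and j: "y ^ j \<in> I"
    by (auto simp: radical_def)
  have "(x + y) ^ (i + j) \<in> I"
    unfolding binomial_ring
  proof (rule sum_mem)
    fix l assume "l \<in> {..i + j}"
    \<comment> \<open>In each term one of the two exponents is large.\<close>
    show "of_nat (i + j choose l) * x ^ l * y ^ (i + j - l) \<in> I"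
    proof (cases "i \<le> l")
      case True
      then show ?thesis using power_mem[OF i] by (intro mult_mem' mult_mem)
    next
      case False
      then have "j \<le> i + j - l" by simp
      then show ?thesis using power_mem[OF j] by (intro mult_mem)
    qed
  qed
  then show "x + y \<in> radical" by (auto simp: radical_def)
next
  fix x r assume "x \<in> radical"
  then show "r * x \<in> radical"
    by (auto simp: radical_def power_mult_distrib intro: mult_mem)
qed

text \<open>
  Applied to the radical of an ideal that contains a power of \<open>p\<close>, this says that congruence of
  \<open>p ^ s\<close>-th powers modulo the radical implies congruence.
\<close>

lemma frobenius_diff:
  assumes p: "Factorial_Ring.prime p" and pI: "of_nat p \<in> I"
  shows "(x - y) ^ (p ^ s) - (x ^ (p ^ s) - y ^ (p ^ s)) \<in> I"
proof -
  let ?P = "p ^ s" and ?b = "x - y"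
  let ?f = "\<lambda>i. of_nat (?P choose i) * y ^ i * ?b ^ (?P - i)"
  have "p > 0" using p prime_gt_0_nat by blast
  then have P: "?P > 0" by simp
  \<comment> \<open>Expanding \<open>x = y + (x - y)\<close> instead of \<open>x - y\<close> avoids a sign that would depend on the parity of \<open>p\<close>.\<close>
  have split: "{..?P} = insert 0 (insert ?P {0<..<?P})"
    using P by auto
  have "x ^ ?P = (y + ?b) ^ ?P" by simp
  also have "\<dots> = sum ?f {..?P}" by (rule binomial_ring)
  also have "\<dots> = ?b ^ ?P + (y ^ ?P + sum ?f {0<..<?P})"
    unfolding split using P by (subst sum.insert; simp)+
  finally have "?b ^ ?P - (x ^ ?P - y ^ ?P) = 0 - sum ?f {0<..<?P}"
    by (simp add: algebra_simps)
  moreover have "sum ?f {0<..<?P} \<in> I"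
  proof (rule sum_mem)
    fix i assume "i \<in> {0<..<?P}"
    then have "p dvd (?P choose i)"
      using prime_power_dvd_binomial[OF p, of i s 0] by simp
    then show "?f i \<in> I"
      by (intro mult_mem' of_nat_mem[OF pI])
  qed
  ultimately show ?thesis
    using diff_mem[OF zero_mem] by simp
qed

text \<open>
  A high \<open>p\<close>-power erases a nilpotent difference: in the expansion of \<open>(b + y) ^ (p ^ J)\<close> with
  \<open>b = x - y\<close> the terms of low degree in \<open>b\<close> carry a binomial coefficient divisible by \<open>p ^ k\<close>, and those
  of high degree contain a vanishing power of \<open>b\<close>.
\<close>

lemma power_prime_power_cong:
  assumes p: "Factorial_Ring.prime p" and pI: "of_nat (p ^ k) \<in> I"
    and xy: "(x - y) ^ r \<in> I" and J: "k + r \<le> J"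
  shows "x ^ (p ^ J) - y ^ (p ^ J) \<in> I"
proof -
  define s where "s = J - k"
  have Js: "J = k + s" and "r \<le> s" using J by (auto simp: s_def)
  \<comment> \<open>so that \<open>b ^ i\<close> vanishes as soon as \<open>i\<close> leaves the range of \<open>prime_power_dvd_binomial\<close>\<close>
  have "s < p ^ s"
    using prime_ge_2_nat[OF p] by (intro less_exp[THEN less_le_trans] power_mono) auto
  then have rs: "r \<le> p ^ s" using \<open>r \<le> s\<close> by simp
  let ?P = "p ^ J" and ?b = "x - y"
  let ?f = "\<lambda>i. of_nat (?P choose i) * ?b ^ i * y ^ (?P - i)"
  have "x ^ ?P = (?b + y) ^ ?P" by simp
  also have "\<dots> = sum ?f {..?P}" by (rule binomial_ring)
  also have "{..?P} = insert 0 {0<..?P}" by auto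
  also have "sum ?f \<dots> = y ^ ?P + sum ?f {0<..?P}" by simp
  finally have "x ^ ?P - y ^ ?P = sum ?f {0<..?P}" by (simp add: algebra_simps)
  also have "\<dots> \<in> I"
  proof (rule sum_mem)
    fix i assume i: "i \<in> {0<..?P}"
    show "?f i \<in> I"
    proof (cases "i < p ^ s")
      case True
      then have "p ^ k dvd (?P choose i)"
        using prime_power_dvd_binomial[OF p, of i s k] i power_le_dvd[of p "Suc k" _ k]
        by (simp add: Js)
      then show ?thesis by (intro mult_mem' of_nat_mem[OF pI])
    next
      case False
      then have "?b ^ i \<in> I" using power_mem[OF xy, of i] rs by simp
      then show ?thesis by (intro mult_mem' mult_mem)
    qed
  qed
  finally show ?thesis .
qed

lemma power_diff_mem:
  assumes "x - y \<in> I"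
  shows "x ^ k - y ^ k \<in> I"
  using mult_mem'[OF assms] by (simp add: power_diff_sumr2)

lemma periodic_powers:
  assumes "x ^ Suc m - x \<in> I" and "a > 0"
  shows "x ^ (a + m * c) - x ^ a \<in> I"
proof (induction c)
  case 0
  then show ?case by (simp add: zero_mem)
next
  case (Suc c)
  have "x ^ (a + m * Suc c) - x ^ a
      = x ^ (a + m * c - 1) * (x ^ Suc m - x) + (x ^ (a + m * c) - x ^ a)"
    using assms(2) by (simp add: algebra_simps flip: power_add power_Suc)
  then show ?case using Suc add_mem mult_mem[OF assms(1)] by metis
qed

end

section \<open>Lifting potent elements modulo an ideal\<close>

context comm_ideal
begin

text \<open>
  The lift is \<open>g = x ^ (p ^ J)\<close> for a suitable large \<open>J\<close>, as in the construction of Teichmueller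
  representatives. Since \<open>x\<close> and \<open>x ^ Suc m\<close> differ by a nilpotent modulo \<open>I\<close>, their \<open>p ^ J\<close>-th powers agree,
  so \<open>g\<close> is potent. To keep \<open>g\<close> close to \<open>x\<close>, write \<open>m = p ^ s * t\<close> with \<open>t\<close> prime to \<open>p\<close> and take \<open>J\<close> a
  multiple of \<open>totient t\<close>: then \<open>g\<close> and \<open>x\<close> have congruent \<open>p ^ s\<close>-th powers modulo the radical,
  because powers of \<open>x\<close> are periodic there with period \<open>m\<close>, and Frobenius is injective modulo the
  radical.
\<close>

lemma lift_potent_prime_power:
  assumes p: "Factorial_Ring.prime p" and pI: "of_nat (p ^ k) \<in> I"
    and m: "m > 0" and x: "x ^ Suc m - x \<in> radical"
  shows "\<exists>g. g ^ Suc m - g \<in> I \<and> g - x \<in> radical"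
proof -
  interpret rad: comm_ideal radical by (rule comm_ideal_radical)
  obtain r where r: "(x ^ Suc m - x) ^ r \<in> I" using x by (auto simp: radical_def)
  have p1: "p > 1" using p prime_gt_1_nat by blast
  obtain t where t: "m = p ^ multiplicity p m * t" "\<not> p dvd t"
    using multiplicity_decompose'[of m p] m p1 by auto
  define s where "s = multiplicity p m"
  define J where "J = totient t * (k + r)"
  have t0: "t > 0" using m t(1) by (cases t) auto
  then have "k + r \<le> J" by (simp add: J_def Suc_le_eq)
  have "coprime p t" using p t(2) prime_imp_coprime by blast
  then have "[(p ^ totient t) ^ (k + r) = 1 ^ (k + r)] (mod t)"
    by (intro cong_pow euler_theorem)
  then have "[p ^ J = 1] (mod t)"
    by (simp add: J_def power_mult)
  then obtain c where c: "p ^ J = 1 + t * c"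
    using p1 by (metis cong_sym cong_le_nat one_le_power less_imp_le mult.commute add.commute)
  \<comment> \<open>Multiplying by the power of \<open>p\<close> in \<open>m\<close> turns the congruence modulo \<open>t\<close> into one modulo \<open>m\<close>.\<close>
  have "p ^ (J + s) = p ^ s + m * c"
    using c t(1) by (simp add: s_def power_add algebra_simps)
  then have "x ^ (p ^ (J + s)) - x ^ (p ^ s) \<in> radical"
    using rad.periodic_powers[OF x, of "p ^ s" c] p1 by simp
  then have *: "(x ^ (p ^ J)) ^ (p ^ s) - x ^ (p ^ s) \<in> radical"
    by (simp add: power_add flip: power_mult)
  have "of_nat p \<in> radical" using pI by (auto simp: radical_def)
  then have "(x ^ (p ^ J) - x) ^ (p ^ s) \<in> radical"
    using rad.add_mem[OF rad.frobenius_diff[OF p, of "x ^ (p ^ J)" x s] *] by simp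
  then have "x ^ (p ^ J) - x \<in> radical" by (rule radical_root)
  moreover have "(x ^ (p ^ J)) ^ Suc m - x ^ (p ^ J) \<in> I"
    using power_prime_power_cong[OF p pI r \<open>k + r \<le> J\<close>]
    by (metis power_mult mult.commute)
  ultimately show ?thesis by blast
qed

end

lemma comm_ideal_add_multiples:
  assumes "comm_ideal I"
  shows "comm_ideal {x. \<exists>u. x - a * u \<in> I}"
proof -
  interpret comm_ideal I by fact
  show ?thesis
  proof
    show "0 \<in> {x. \<exists>u. x - a * u \<in> I}"
      using zero_mem by (auto intro: exI[of _ 0])
  next
    fix x y assume "x \<in> {x. \<exists>u. x - a * u \<in> I}" "y \<in> {x. \<exists>u. x - a * u \<in> I}"
    then obtain u v where "x - a * u \<in> I" "y - a * v \<in> I" by auto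
    from add_mem[OF this] show "x + y \<in> {x. \<exists>u. x - a * u \<in> I}"
      by (auto intro!: exI[of _ "u + v"] simp: algebra_simps)
  next
    fix x r assume "x \<in> {x. \<exists>u. x - a * u \<in> I}"
    then obtain u where "x - a * u \<in> I" by auto
    from mult_mem[OF this, of r] show "r * x \<in> {x. \<exists>u. x - a * u \<in> I}"
      by (auto intro!: exI[of _ "r * u"] simp: algebra_simps)
  qed
qed

text \<open>
  The uniqueness half of the Chinese remainder theorem: for comaximal \<open>a\<close> and \<open>b\<close> with \<open>a b\<close> in \<open>I\<close>, the intersection
  of \<open>I + (a)\<close> and \<open>I + (b)\<close> is \<open>I\<close>.
\<close>

lemma coprime_multiples_Int:
  assumes I: "comm_ideal I" and ab: "a * b \<in> I" and bez: "s * a + t * b = 1"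
    and x: "x - a * u \<in> I" "x - b * v \<in> I"
  shows "x \<in> I"
proof -
  interpret comm_ideal I by fact
  have "x = (s * a + t * b) * x" by (simp add: bez)
  also have "\<dots> = (s * a) * (x - b * v) + (t * b) * (x - a * u) + (s * v + t * u) * (a * b)"
    by (simp add: algebra_simps)
  also have "\<dots> \<in> I"
    by (intro add_mem mult_mem x ab)
  finally show ?thesis .
qed

text \<open>
  A prime power \<open>A\<close> splits off \<open>N = A * B\<close>. Lifts modulo \<open>I + (A)\<close>, by \<open>lift_potent_prime_power\<close>, and modulo
  \<open>I + (B)\<close>, by induction, are glued with a Bezout relation. One power of \<open>x\<close> need not serve
  all primes at once, hence the detour through the two factors.
\<close>

lemma lift_potent:
  fixes x :: "'a :: comm_ring_1"
  assumes "comm_ideal I" and "N > 0" and "of_nat N \<in> I"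
    and "m > 0" and "x ^ Suc m - x \<in> comm_ideal.radical I"
  shows "\<exists>g. g ^ Suc m - g \<in> I \<and> g - x \<in> comm_ideal.radical I"
  using assms(1-3,5)
proof (induction N arbitrary: I rule: less_induct)
  case (less N I)
  interpret comm_ideal I by fact
  show ?case
  proof (cases "N = 1")
    case True
    then have "y \<in> I" for y using less.prems(3) mult_mem[of 1 y] by simp
    then show ?thesis using subset_radical by blast
  next
    case False
    then obtain p where p: "Factorial_Ring.prime p" "p dvd N"
      using prime_factor_nat by blast
    have p1: "p > 1" using p prime_gt_1_nat by blast
    obtain B where B: "N = p ^ multiplicity p N * B" "\<not> p dvd B"
      using multiplicity_decompose'[of N p] less.prems(2) p1 by auto
    define k where "k = multiplicity p N"
    define A where "A = p ^ k"
    have N: "N = A * B" using B by (simp add: A_def k_def)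
    have "B > 0" using less.prems(2) N by (cases B) auto
    have "k > 0" using p less.prems(2) by (simp add: k_def prime_multiplicity_gt_zero_iff)
    then have "A > 1" unfolding A_def using one_less_power[OF p1] by blast
    then have "B < N" using N \<open>B > 0\<close> by simp
    have "coprime A B" using p B(2) prime_imp_coprime by (auto simp: A_def)
    then have "coprime (int A) (int B)" by simp
    then obtain s0 t0 where "s0 * int A + t0 * int B = 1"
      using bezout_int by (metis coprime_imp_gcd_eq_1)
    then have "(of_int (s0 * int A + t0 * int B) :: 'a) = 1" by simp
    then obtain s t :: 'a where bez: "s * of_nat A + t * of_nat B = 1"
      by (metis of_int_add of_int_mult of_int_of_nat_eq)
    let ?plus = "\<lambda>a. {y. \<exists>u. y - of_nat a * u \<in> I}"
    have sub: "I \<subseteq> ?plus a" for a by (auto intro: exI[of _ 0])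
    have rad_sub: "radical \<subseteq> comm_ideal.radical (?plus a)" for a
      using sub[of a] unfolding radical_def
        comm_ideal.radical_def[OF comm_ideal_add_multiples[OF less.prems(1)]] by blast
    have self: "of_nat a \<in> ?plus a" for a
      using zero_mem by (auto intro: exI[of _ 1])
    interpret PA: comm_ideal "?plus A" by (rule comm_ideal_add_multiples[OF less.prems(1)])
    interpret PB: comm_ideal "?plus B" by (rule comm_ideal_add_multiples[OF less.prems(1)])
    obtain g where g: "g ^ Suc m - g \<in> ?plus A" "g - x \<in> PA.radical"
      using PA.lift_potent_prime_power[OF p(1) _ assms(4), of k x] self[of A]
        rad_sub[of A] less.prems(4) unfolding A_def by blast
    obtain h where h: "h ^ Suc m - h \<in> ?plus B" "h - x \<in> PB.radical"
      using less.IH[OF \<open>B < N\<close> PB.comm_ideal_axioms \<open>B > 0\<close> self[of B]]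
        rad_sub[of B] less.prems(4) by blast
    define w where "w = t * of_nat B * g + s * of_nat A * h"
    have t: "t * of_nat B = 1 - s * of_nat A" using bez by (simp add: algebra_simps)
    have "w - g = (s * (h - g)) * of_nat A" unfolding w_def t by (simp add: algebra_simps)
    then have wg: "w - g \<in> ?plus A" using PA.mult_mem[OF self] by metis
    have s: "s * of_nat A = 1 - t * of_nat B" using bez by (simp add: algebra_simps)
    have "w - h = (t * (g - h)) * of_nat B" unfolding w_def s by (simp add: algebra_simps)
    then have wh: "w - h \<in> ?plus B" using PB.mult_mem[OF self] by metis
    have meet: "y \<in> I" if "y \<in> ?plus A" "y \<in> ?plus B" for y
      using that coprime_multiples_Int[OF less.prems(1) _ bez] less.prems(3) N by auto
    have "w ^ Suc m - w = (w ^ Suc m - g ^ Suc m) + (g ^ Suc m - g) - (w - g)" by simp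
    then have 1: "w ^ Suc m - w \<in> ?plus A"
      using PA.diff_mem[OF PA.add_mem[OF PA.power_diff_mem[OF wg, of "Suc m"] g(1)] wg] by simp
    have "w ^ Suc m - w = (w ^ Suc m - h ^ Suc m) + (h ^ Suc m - h) - (w - h)" by simp
    then have 2: "w ^ Suc m - w \<in> ?plus B"
      using PB.diff_mem[OF PB.add_mem[OF PB.power_diff_mem[OF wh, of "Suc m"] h(1)] wh] by simp
    interpret RA: comm_ideal PA.radical by (rule PA.comm_ideal_radical)
    interpret RB: comm_ideal PB.radical by (rule PB.comm_ideal_radical)
    have "w - x \<in> PA.radical"
      using RA.add_mem[OF subsetD[OF PA.subset_radical wg] g(2)] by simp
    then obtain i where i: "(w - x) ^ i \<in> ?plus A" by (auto simp: PA.radical_def)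
    have "w - x \<in> PB.radical"
      using RB.add_mem[OF subsetD[OF PB.subset_radical wh] h(2)] by simp
    then obtain j where j: "(w - x) ^ j \<in> ?plus B" by (auto simp: PB.radical_def)
    have "(w - x) ^ (i + j) \<in> I"
      using PA.power_mem[OF i, of "i + j"] PB.power_mem[OF j, of "i + j"] by (intro meet) auto
    then have "w - x \<in> radical" by (auto simp: radical_def)
    then show ?thesis using meet[OF 1 2] by blast
  qed
qed

section \<open>Evaluating integer polynomials in a ring\<close>

context ring
begin

text \<open>
  Evaluation at \<open>a\<close> is a homomorphism from \<open>int poly\<close> onto the subring generated by \<open>a\<close>. Its kernel is an
  ideal of a commutative ring, which brings the lifting lemma to bear on one element of a
  noncommutative ring, and all its values commute with each other.
\<close>

definition peval :: "'a \<Rightarrow> int poly \<Rightarrow> 'a" where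
  "peval a q = fold_coeffs (\<lambda>c r. [c] \<cdot> \<one> \<oplus> a \<otimes> r) q \<zero>"

lemma peval_0 [simp]: "peval a 0 = \<zero>"
  by (simp add: peval_def)

lemma peval_pCons [simp]:
  assumes "a \<in> carrier R"
  shows "peval a (pCons c q) = [c] \<cdot> \<one> \<oplus> a \<otimes> peval a q"
proof (cases "c = 0 \<and> q = 0")
  case True
  then show ?thesis using assms by (simp add: add_pow_int_ge)
next
  case False
  then show ?thesis by (auto simp: peval_def)
qed

lemma peval_closed [simp]: "a \<in> carrier R \<Longrightarrow> peval a q \<in> carrier R"
  by (induction q) simp_all

lemma peval_commutes:
  assumes a: "a \<in> carrier R" and z: "z \<in> carrier R" and az: "a \<otimes> z = z \<otimes> a"
  shows "peval a q \<otimes> z = z \<otimes> peval a q"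
proof (induction q)
  case 0
  then show ?case using z by simp
next
  case (pCons c q)
  have "a \<otimes> peval a q \<otimes> z = a \<otimes> (z \<otimes> peval a q)"
    using a z pCons.IH by (simp add: m_assoc)
  also have "\<dots> = z \<otimes> (a \<otimes> peval a q)"
    using a z by (simp add: az flip: m_assoc)
  finally show ?case
    using a z by (simp add: l_distr r_distr add_pow_ldistr_int add_pow_rdistr_int)
qed

lemma peval_add:
  assumes a: "a \<in> carrier R"
  shows "peval a (q + r) = peval a q \<oplus> peval a r"
proof (induction q r rule: poly_induct2)
  case 0
  then show ?case by simp
next
  case (pCons c q d r)
  then show ?case
    using a by (simp add: add.int_pow_mult r_distr a_ac)
qed

lemma peval_uminus:
  assumes "a \<in> carrier R"
  shows "peval a (- q) = \<ominus> peval a q"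
  using peval_add[OF assms, of "- q" q] assms by (simp add: minus_equality)

lemma peval_diff:
  assumes "a \<in> carrier R"
  shows "peval a (q - r) = peval a q \<ominus> peval a r"
  using peval_add[OF assms, of q "- r"] assms by (simp add: peval_uminus a_minus_def)

lemma peval_smult:
  assumes a: "a \<in> carrier R"
  shows "peval a (smult c q) = [c] \<cdot> peval a q"
proof (induction q)
  case 0
  then show ?case by (simp add: add.int_pow_one)
next
  case (pCons d q)
  then show ?case
    using a by (simp add: add.int_pow_distrib add.int_pow_pow add_pow_rdistr_int mult.commute)
qed

lemma peval_mult:
  assumes a: "a \<in> carrier R"
  shows "peval a (q * r) = peval a q \<otimes> peval a r"
proof (induction q)
  case 0
  then show ?case using a by simp
next
  case (pCons c q)
  then show ?case
    using a by (simp add: peval_add peval_smult l_distr m_assoc add_pow_ldistr_int add_pow_int_ge)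
qed

lemma peval_1: "a \<in> carrier R \<Longrightarrow> peval a 1 = \<one>"
  by (simp add: one_pCons add_pow_int_ge)

lemma peval_power:
  assumes "a \<in> carrier R"
  shows "peval a (q ^ k) = peval a q [^] k"
proof (induction k)
  case 0
  then show ?case using assms by (simp add: peval_1)
next
  case (Suc k)
  then show ?case
    using assms nat_pow_Suc2[of "peval a q" k] by (simp add: peval_mult)
qed

lemma peval_X: "a \<in> carrier R \<Longrightarrow> peval a [:0, 1:] = a"
  by (simp add: add_pow_int_ge)

lemma comm_ideal_peval_kernel:
  "a \<in> carrier R \<Longrightarrow> comm_ideal {q. peval a q = \<zero>}"
  by unfold_locales (simp_all add: peval_add peval_mult)

section \<open>Nilpotent and idempotent elements\<close>

lemma nilpotentsI: "x \<in> carrier R \<Longrightarrow> x [^] (k::nat) = \<zero> \<Longrightarrow> x \<in> nilpotents R"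
  unfolding nilpotents_def by (auto intro!: exI[of _ "Suc k"])

lemma nilpotentsE:
  assumes "x \<in> nilpotents R"
  obtains k :: nat where "x \<in> carrier R" "k > 0" "x [^] k = \<zero>"
  using assms by (auto simp: nilpotents_def)

lemma nilpotents_closed: "x \<in> nilpotents R \<Longrightarrow> x \<in> carrier R"
  by (simp add: nilpotents_def)

lemma nilpotents_mult:
  assumes b: "b \<in> nilpotents R" and c: "c \<in> carrier R" and bc: "b \<otimes> c = c \<otimes> b"
  shows "b \<otimes> c \<in> nilpotents R"
proof -
  obtain k :: nat where "b \<in> carrier R" "b [^] k = \<zero>" using b by (rule nilpotentsE)
  then show ?thesis
    using c bc by (intro nilpotentsI[of _ k]) (simp_all add: pow_mult_distrib)
qed

lemma nilpotents_power:
  assumes "x [^] (k::nat) \<in> nilpotents R" "x \<in> carrier R"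
  shows "x \<in> nilpotents R"
  using assms by (auto elim!: nilpotentsE simp: nat_pow_pow intro: nilpotentsI)

lemma nilpotents_uminus:
  assumes "b \<in> nilpotents R"
  shows "\<ominus> b \<in> nilpotents R"
proof -
  have b: "b \<in> carrier R" using assms by (rule nilpotents_closed)
  have "b \<otimes> \<ominus> \<one> = \<ominus> b" using b by (simp add: r_minus)
  moreover have "b \<otimes> \<ominus> \<one> = \<ominus> \<one> \<otimes> b" using b by (simp add: r_minus l_minus)
  ultimately show ?thesis using nilpotents_mult[OF assms, of "\<ominus> \<one>"] by simp
qed

lemma complement_idempotent:
  assumes e: "e \<in> carrier R" "e \<otimes> e = e"
  defines "f \<equiv> \<one> \<ominus> e"
  shows "f \<in> carrier R" "f \<otimes> f = f" "e \<otimes> f = \<zero>" "f \<otimes> e = \<zero>" "e \<oplus> f = \<one>"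
proof -
  show f: "f \<in> carrier R" using e by (simp add: f_def)
  show ef: "e \<otimes> f = \<zero>" and fe: "f \<otimes> e = \<zero>"
    using e by (simp_all add: f_def a_minus_def r_distr l_distr r_minus l_minus r_neg)
  have "f \<otimes> f = (\<one> \<ominus> e) \<otimes> f" by (simp add: f_def)
  also have "\<dots> = f \<ominus> e \<otimes> f" using e f by (simp add: a_minus_def l_distr l_minus)
  finally show "f \<otimes> f = f" using f ef by (simp add: a_minus_def)
  show "e \<oplus> f = \<one>" using e by (simp add: f_def a_minus_def a_lcomm[of e] r_neg)
qed

lemma idempotent_power:
  "e \<otimes> e = e \<Longrightarrow> e \<in> carrier R \<Longrightarrow> k > 0 \<Longrightarrow> e [^] (k::nat) = e"
proof (induction k)
  case (Suc k)
  then show ?case by (cases "k = 0") simp_all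
qed simp

text \<open>
  A power of \<open>z\<close> is the sum of the powers of its two Peirce components, so that no binomial
  expansion is needed.
\<close>

lemma nilpotents_peirce:
  assumes e: "e \<in> carrier R" "e \<otimes> e = e" and z: "z \<in> carrier R" and ez: "e \<otimes> z = z \<otimes> e"
    and "e \<otimes> z \<in> nilpotents R" and "(\<one> \<ominus> e) \<otimes> z \<in> nilpotents R"
  shows "z \<in> nilpotents R"
proof -
  define f where "f = \<one> \<ominus> e"
  note f = complement_idempotent[OF e, folded f_def]
  have fz: "f \<otimes> z = z \<otimes> f"
    using e z ez by (simp add: f_def a_minus_def l_distr r_distr l_minus r_minus)
  obtain i :: nat where i: "i > 0" "(e \<otimes> z) [^] i = \<zero>" using assms(5) by (rule nilpotentsE)
  obtain j :: nat where j: "j > 0" "(f \<otimes> z) [^] j = \<zero>"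
    using assms(6) by (auto simp: f_def elim: nilpotentsE)
  have ei: "e \<otimes> z [^] i = \<zero>"
    using pow_mult_distrib[OF ez e(1) z, of i] i idempotent_power[OF e(2,1)] by simp
  have fj: "f \<otimes> z [^] j = \<zero>"
    using pow_mult_distrib[OF fz f(1) z, of j] j idempotent_power[OF f(2,1)] by simp
  have "z [^] (i + j) = (e \<oplus> f) \<otimes> z [^] (i + j)" using f(5) z by simp
  also have "\<dots> = e \<otimes> z [^] i \<otimes> z [^] j \<oplus> f \<otimes> z [^] j \<otimes> z [^] i"
    using e f(1) z by (simp add: l_distr m_assoc nat_pow_mult add.commute)
  also have "\<dots> = \<zero>" using z by (simp add: ei fj)
  finally show ?thesis using z by (rule nilpotentsI[rotated])
qed

text \<open>
  The correction \<open>c\<close> is a polynomial in \<open>p\<close> and \<open>b\<close>; the induction only has to remember that it commutes with both.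
\<close>

lemma power_add_commuting:
  assumes p: "p \<in> carrier R" and b: "b \<in> carrier R" and pb: "p \<otimes> b = b \<otimes> p"
  obtains c where "c \<in> carrier R" "b \<otimes> c = c \<otimes> b" "p \<otimes> c = c \<otimes> p"
    "(p \<oplus> b) [^] (k::nat) = p [^] k \<oplus> b \<otimes> c"
proof -
  have "\<exists>c \<in> carrier R. b \<otimes> c = c \<otimes> b \<and> p \<otimes> c = c \<otimes> p \<and>
    (p \<oplus> b) [^] k = p [^] k \<oplus> b \<otimes> c"
  proof (induction k)
    case 0
    show ?case using p b by (intro bexI[of _ \<zero>]) simp_all
  next
    case (Suc k)
    then obtain c where c: "c \<in> carrier R" "b \<otimes> c = c \<otimes> b" "p \<otimes> c = c \<otimes> p"
      "(p \<oplus> b) [^] k = p [^] k \<oplus> b \<otimes> c" by blast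
    let ?d = "p [^] k \<oplus> c \<otimes> p \<oplus> c \<otimes> b"
    have bpk: "b \<otimes> p [^] k = p [^] k \<otimes> b"
      using group_commutes_pow[OF pb p b, of k] by simp
    have bcp: "b \<otimes> (c \<otimes> p) = c \<otimes> p \<otimes> b"
      using p b c(1) by (metis c(2) m_assoc pb)
    have pcb: "p \<otimes> (c \<otimes> b) = c \<otimes> b \<otimes> p"
      using p b c(1) by (metis c(3) m_assoc pb)
    have cl: "p [^] k \<in> carrier R" using p by simp
    have "(p \<oplus> b) [^] Suc k = (p [^] k \<oplus> b \<otimes> c) \<otimes> (p \<oplus> b)" by (simp add: c(4))
    also have "\<dots> = p [^] Suc k \<oplus> (b \<otimes> p [^] k \<oplus> b \<otimes> (c \<otimes> p) \<oplus> b \<otimes> (c \<otimes> b))"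
      using p b c(1) cl by (simp add: l_distr r_distr m_assoc bpk a_ac)
    also have "\<dots> = p [^] Suc k \<oplus> b \<otimes> ?d"
      using p b c(1) cl by (simp add: r_distr)
    finally have "(p \<oplus> b) [^] Suc k = p [^] Suc k \<oplus> b \<otimes> ?d" .
    moreover have "b \<otimes> (c \<otimes> b) = c \<otimes> b \<otimes> b"
      using b c(1,2) by (metis m_assoc)
    then have "b \<otimes> ?d = ?d \<otimes> b"
      using p b c(1) cl bpk bcp by (simp add: r_distr l_distr)
    moreover have "p \<otimes> (c \<otimes> p) = c \<otimes> p \<otimes> p"
      using p c(1,3) by (metis m_assoc)
    then have "p \<otimes> ?d = ?d \<otimes> p"
      using p b c(1) cl pcb nat_pow_Suc2[OF p, of k]
      by (simp add: r_distr l_distr)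
    ultimately show ?case using p b c(1) by (intro bexI[of _ ?d]) simp_all
  qed
  then show ?thesis using that by blast
qed

section \<open>Potent elements, idempotents and units\<close>

lemma potent_power_idempotent:
  assumes p: "p \<in> carrier R" "p [^] Suc m = p" and m: "m > 0"
  shows "p [^] m \<otimes> p [^] m = p [^] m"
proof -
  obtain l where l: "m = Suc l" using m by (cases m) auto
  have "p [^] m \<otimes> p [^] m = p [^] l \<otimes> p [^] Suc m"
    using p(1) unfolding nat_pow_mult[OF p(1)] by (simp add: l add.commute)
  also have "\<dots> = p [^] m" using p by (simp add: l)
  finally show ?thesis .
qed

lemma orthogonal_idempotent_power:
  assumes x: "x \<in> carrier R" and f: "f \<in> carrier R" "f \<otimes> f = f"
    and "x \<otimes> f = \<zero>" "f \<otimes> x = \<zero>"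
  shows "(x \<oplus> f) [^] Suc k = x [^] Suc k \<oplus> f"
proof (induction k)
  case 0
  then show ?case using x f by simp
next
  case (Suc k)
  have "x [^] Suc k \<otimes> f = \<zero>" using assms by (simp add: m_assoc)
  have "(x \<oplus> f) [^] Suc (Suc k) = (x [^] Suc k \<oplus> f) \<otimes> (x \<oplus> f)"
    using Suc by (metis nat_pow_Suc)
  also have "\<dots> = x [^] Suc k \<otimes> x \<oplus> x [^] Suc k \<otimes> f \<oplus> (f \<otimes> x \<oplus> f \<otimes> f)"
    using x f by (simp add: l_distr r_distr a_ac del: nat_pow_Suc)
  also have "\<dots> = x [^] Suc (Suc k) \<oplus> f"
    unfolding \<open>x [^] Suc k \<otimes> f = \<zero>\<close> using assms by simp
  finally show ?case .
qed

lemma Units_of_inverses: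
  assumes "u \<in> carrier R" "l \<in> carrier R" "r \<in> carrier R" "l \<otimes> u = \<one>" "u \<otimes> r = \<one>"
  shows "u \<in> Units R"
proof -
  have "l = l \<otimes> (u \<otimes> r)" using assms(2,5) by simp
  also have "\<dots> = r" using assms(1-4) by (simp flip: m_assoc)
  finally show ?thesis using assms by (auto simp: Units_def)
qed

lemma Units_of_power_eq_one:
  assumes v: "v \<in> carrier R" and "v [^] (m::nat) = \<one>" and "m > 0"
  shows "v \<in> Units R"
proof -
  obtain l where "m = Suc l" using assms(3) by (cases m) auto
  then show ?thesis
    using assms nat_pow_Suc2[OF v, of l]
    by (intro Units_of_inverses[of v "v [^] l" "v [^] l"]) simp_all
qed

text \<open>
  Here \<open>e = p ^ m\<close>, and \<open>v = p + (1 - e)\<close> acts as \<open>p\<close> on the corner of \<open>e\<close>, where \<open>p\<close> is invertible, and as the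
  identity on the complementary corner. The two parts annihilate each other, so \<open>v ^ m = e + (1 - e) = 1\<close>.
\<close>

lemma potent_eq_idempotent_times_unit:
  assumes p: "p \<in> carrier R" "p [^] Suc m = p" and m: "m > 0"
  obtains e v where "e \<in> idempotents R" "v \<in> Units R" "v [^] Suc m = v"
    "p = e \<otimes> v" "e \<otimes> v = v \<otimes> e"
proof -
  define e where "e = p [^] m"
  have e: "e \<in> carrier R" "e \<otimes> e = e"
    using p potent_power_idempotent[OF p m] by (simp_all add: e_def)
  define f where "f = \<one> \<ominus> e"
  note f = complement_idempotent[OF e, folded f_def]
  have pe: "p \<otimes> e = p" and ep: "e \<otimes> p = p"
    using p nat_pow_Suc2[OF p(1), of m] by (simp_all add: e_def)
  have "p \<otimes> f = p \<otimes> (e \<otimes> f)" using p(1) e(1) f(1) by (simp add: pe flip: m_assoc)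
  then have pf: "p \<otimes> f = \<zero>" using f p by simp
  have "f \<otimes> p = f \<otimes> e \<otimes> p" using p(1) e(1) f(1) by (simp add: ep m_assoc)
  then have fp: "f \<otimes> p = \<zero>" using f p by simp
  define v where "v = p \<oplus> f"
  have v: "v \<in> carrier R" using p f by (simp add: v_def)
  obtain l where l: "m = Suc l" using m by (cases m) auto
  have vm: "v [^] m = \<one>"
    using orthogonal_idempotent_power[OF p(1) f(1,2) pf fp, of l] f(5) unfolding v_def l e_def by simp
  have ev: "e \<otimes> v = p" and ve: "v \<otimes> e = p"
    using p e f by (simp_all add: v_def r_distr l_distr pe ep)
  show ?thesis
  proof (rule that[of e v])
    show "e \<in> idempotents R" using e by (simp add: idempotents_def)
    show "v \<in> Units R" using v vm m by (rule Units_of_power_eq_one)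
    show "v [^] Suc m = v" using v vm by simp
  qed (simp_all add: ev ve)
qed

text \<open>
  The one-sided relation already suffices to move every inner \<open>e\<close> in \<open>(e v) (e v) \<dots> (e v)\<close> out of the
  way, which leaves \<open>v ^ m * e * v\<close>, and \<open>v ^ m = 1\<close>.
\<close>

lemma idempotent_times_potent_unit:
  assumes e: "e \<in> carrier R" "e \<otimes> e = e" and v: "v \<in> Units R" "v [^] Suc m = v"
    and ve: "v \<otimes> e = e \<otimes> v \<otimes> e"
  shows "(e \<otimes> v) [^] Suc m = e \<otimes> v"
proof -
  have vc: "v \<in> carrier R" using v by blast
  have "v \<otimes> v [^] m = v \<otimes> \<one>" using v vc nat_pow_Suc2[OF vc, of m] by simp
  then have vm: "v [^] m = \<one>" using Units_l_cancel[OF v(1), of "v [^] m" \<one>] vc by simp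
  have "(e \<otimes> v) [^] Suc k = v [^] k \<otimes> e \<otimes> v" for k
  proof (induction k)
    case 0
    then show ?case using e vc by simp
  next
    case (Suc k)
    have "(e \<otimes> v) [^] Suc (Suc k) = v [^] k \<otimes> (e \<otimes> v \<otimes> e) \<otimes> v"
      using Suc e(1) vc by (metis (no_types, lifting) m_assoc m_closed nat_pow_Suc nat_pow_closed)
    also have "\<dots> = v [^] Suc k \<otimes> e \<otimes> v"
      unfolding ve[symmetric] using e(1) vc by (simp add: m_assoc)
    finally show ?case .
  qed
  then show ?thesis using vm e vc by (simp del: nat_pow_Suc)
qed

section \<open>Fitting decomposition of strongly \<open>\<pi>\<close>-regular elements\<close>

text \<open>
  The complement \<open>1 - e\<close> contributes only itself to the product, since \<open>x (1 - e) = 0 = (1 - e) y\<close>. So a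
  one-sided inverse in the corner ring of \<open>e\<close> extends to the whole ring.
\<close>

lemma peirce_inverse:
  assumes e: "e \<in> carrier R" "e \<otimes> e = e"
    and x: "x \<in> carrier R" "x \<otimes> e = x" and y: "y \<in> carrier R" "e \<otimes> y = y"
    and xy: "x \<otimes> y = e"
  shows "(x \<oplus> (\<one> \<ominus> e)) \<otimes> (y \<oplus> (\<one> \<ominus> e)) = \<one>"
proof -
  define f where "f = \<one> \<ominus> e"
  note f = complement_idempotent[OF e, folded f_def]
  have "x \<otimes> f = \<zero>" using e x f by (metis m_assoc r_null)
  moreover have "f \<otimes> y = \<zero>" using e y f by (metis m_assoc l_null)
  ultimately show ?thesis
    using e x y xy f unfolding f_def[symmetric] by (simp add: l_distr r_distr)
qed

lemma strongly_pi_regular_power: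
  fixes k j :: nat
  assumes a: "a \<in> carrier R"
    and k: "a [^] k \<in> (a [^] (k + 1) <# carrier R) \<inter> (carrier R #> a [^] (k + 1))"
  shows "\<exists>z \<in> carrier R. a [^] k = a [^] (k + j) \<otimes> z"
    and "\<exists>w \<in> carrier R. a [^] k = w \<otimes> a [^] (k + j)"
proof -
  obtain x y where x: "x \<in> carrier R" "a [^] k = a [^] (k + 1) \<otimes> x"
    and y: "y \<in> carrier R" "a [^] k = y \<otimes> a [^] (k + 1)"
    using k unfolding l_coset_def r_coset_def by blast
  show "\<exists>z \<in> carrier R. a [^] k = a [^] (k + j) \<otimes> z"
  proof (induction j)
    case 0
    show ?case using a by (intro bexI[of _ \<one>]) simp_all
  next
    case (Suc j)
    then obtain z where z: "z \<in> carrier R" "a [^] k = a [^] (k + j) \<otimes> z" by blast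
    note z(2)
    also have "a [^] (k + j) \<otimes> z = a [^] j \<otimes> a [^] k \<otimes> z"
      using a by (simp add: nat_pow_mult add.commute)
    also have "\<dots> = a [^] j \<otimes> (a [^] (k + 1) \<otimes> x) \<otimes> z"
      by (simp only: x(2)[symmetric])
    also have "\<dots> = a [^] (k + Suc j) \<otimes> (x \<otimes> z)"
      using a x(1) z(1) nat_pow_mult[OF a, of j "k + 1"]
      by (simp add: add_ac del: nat_pow_Suc flip: m_assoc)
    finally show ?case using x(1) z(1) by blast
  qed
  show "\<exists>w \<in> carrier R. a [^] k = w \<otimes> a [^] (k + j)"
  proof (induction j)
    case 0
    show ?case using a by (intro bexI[of _ \<one>]) simp_all
  next
    case (Suc j)
    then obtain w where w: "w \<in> carrier R" "a [^] k = w \<otimes> a [^] (k + j)" by blast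
    note w(2)
    also have "w \<otimes> a [^] (k + j) = w \<otimes> (a [^] k \<otimes> a [^] j)"
      using a by (simp add: nat_pow_mult)
    also have "\<dots> = w \<otimes> (y \<otimes> a [^] (k + 1) \<otimes> a [^] j)"
      by (simp only: y(2)[symmetric])
    also have "\<dots> = (w \<otimes> y) \<otimes> a [^] (k + Suc j)"
      using a y(1) w(1) nat_pow_mult[OF a, of "k + 1" j]
      by (simp add: m_assoc del: nat_pow_Suc)
    finally show ?case using y(1) w(1) by blast
  qed
qed

text \<open>
  With \<open>c = a ^ k\<close>, iterating the hypothesis gives \<open>c = c\<^sup>2 z = w c\<^sup>2\<close>. Then \<open>e = c z = w c\<close> is an idempotent that
  acts as the identity on \<open>c\<close>, and \<open>s = w e = e z\<close> is a two-sided inverse of \<open>c\<close> in the corner of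
  \<open>e\<close>. Hence \<open>a\<close> is invertible in that corner, with inverses \<open>a ^ (k - 1) s\<close> and \<open>s a ^ (k - 1)\<close>, and nilpotent in the
  complementary one, since \<open>(1 - e) c = 0\<close>.
\<close>

lemma fitting_idempotent:
  fixes k :: nat
  assumes a: "a \<in> carrier R" and k: "k > 0"
    and reg: "a [^] k \<in> (a [^] (k + 1) <# carrier R) \<inter> (carrier R #> a [^] (k + 1))"
  obtains e where "e \<in> carrier R" "e \<otimes> e = e" "e \<otimes> a = a \<otimes> e"
    "(\<one> \<ominus> e) \<otimes> a \<in> nilpotents R" "a \<otimes> e \<oplus> (\<one> \<ominus> e) \<in> Units R"
proof -
  define c where "c = a [^] k"
  have c: "c \<in> carrier R" using a by (simp add: c_def)
  have cc: "c \<otimes> c = a [^] (k + k)" using a by (simp add: c_def nat_pow_mult)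
  have "\<exists>z \<in> carrier R. c = c \<otimes> c \<otimes> z"
    unfolding cc unfolding c_def by (rule strongly_pi_regular_power(1)[OF a reg])
  then obtain z where z: "z \<in> carrier R" "c \<otimes> c \<otimes> z = c" by - (erule bexE, erule that, erule sym)
  have "\<exists>w \<in> carrier R. c = w \<otimes> (c \<otimes> c)"
    unfolding cc unfolding c_def by (rule strongly_pi_regular_power(2)[OF a reg])
  then obtain w where w: "w \<in> carrier R" "w \<otimes> (c \<otimes> c) = c" by - (erule bexE, erule that, erule sym)
  define e where "e = c \<otimes> z"
  have e: "e \<in> carrier R" using c z by (simp add: e_def)
  have "w \<otimes> (c \<otimes> c) \<otimes> z = w \<otimes> (c \<otimes> c \<otimes> z)" using c z(1) w(1) by (simp add: m_assoc)
  then have ewc: "e = w \<otimes> c" unfolding z(2) w(2) by (simp add: e_def)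
  have ec: "e \<otimes> c = c" using c w by (simp add: ewc m_assoc)
  have ce: "c \<otimes> e = c" using c z by (simp add: e_def flip: m_assoc)
  have "e \<otimes> e = e \<otimes> c \<otimes> z" using c z(1) e by (simp add: e_def m_assoc)
  then have ee: "e \<otimes> e = e" by (simp only: ec) (simp add: e_def)
  have ac: "a \<otimes> c = c \<otimes> a" using a nat_pow_Suc2[OF a, of k] by (simp add: c_def)
  \<comment> \<open>\<open>e\<close> commutes with \<open>a\<close>, since both products equal \<open>e a e\<close>: one by \<open>e = c z\<close>, the other by \<open>e = w c\<close>.\<close>
  have "e \<otimes> a \<otimes> e = e \<otimes> (a \<otimes> c) \<otimes> z" using a c z e by (simp add: e_def m_assoc)
  also have "\<dots> = (e \<otimes> c) \<otimes> a \<otimes> z" using a c z e by (simp add: ac m_assoc)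
  also have "\<dots> = a \<otimes> c \<otimes> z" by (simp only: ec ac)
  also have "\<dots> = a \<otimes> e" using a c z by (simp add: e_def m_assoc)
  finally have 1: "e \<otimes> a \<otimes> e = a \<otimes> e" .
  have "e \<otimes> a \<otimes> e = w \<otimes> (c \<otimes> a) \<otimes> e" using a c w e by (simp add: ewc m_assoc)
  also have "\<dots> = w \<otimes> a \<otimes> (c \<otimes> e)" using a c w e by (simp only: ac[symmetric]) (simp add: m_assoc)
  also have "\<dots> = w \<otimes> (c \<otimes> a)" using a c w by (simp add: ce m_assoc ac)
  also have "\<dots> = e \<otimes> a" using a c w by (simp add: ewc m_assoc)
  finally have ea: "e \<otimes> a = a \<otimes> e" using 1 by simp
  define f where "f = \<one> \<ominus> e"
  note f = complement_idempotent[OF e ee, folded f_def]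
  have fa: "f \<otimes> a = a \<otimes> f"
    using a e ea by (simp add: f_def a_minus_def l_distr r_distr l_minus r_minus)
  have "(f \<otimes> a) [^] k = f \<otimes> (e \<otimes> c)"
    using pow_mult_distrib[OF fa f(1) a, of k] idempotent_power[OF f(2,1) k] ec
    by (simp add: c_def)
  also have "\<dots> = \<zero>" using c e f by (simp flip: m_assoc)
  finally have nil: "f \<otimes> a \<in> nilpotents R"
    using a f(1) by (intro nilpotentsI[of _ k]) simp_all
  define s where "s = w \<otimes> e"
  have s: "s \<in> carrier R" using w e by (simp add: s_def)
  have "s = w \<otimes> c \<otimes> z" using w(1) c z(1) by (simp add: s_def e_def m_assoc)
  then have s': "s = e \<otimes> z" by (simp add: ewc)
  have es: "e \<otimes> s = s" using e z(1) by (simp add: s' ee flip: m_assoc)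
  have se: "s \<otimes> e = s" using e w(1) by (simp add: s_def ee m_assoc)
  have "c \<otimes> s = c \<otimes> e \<otimes> z" using c e z(1) by (simp add: s' m_assoc)
  then have cs: "c \<otimes> s = e" by (simp only: ce) (simp add: e_def)
  have "s \<otimes> c = w \<otimes> (e \<otimes> c)" using c e w(1) by (simp add: s_def m_assoc)
  then have sc: "s \<otimes> c = e" by (simp only: ec) (simp add: ewc)
  obtain l where l: "k = Suc l" using k by (cases k) auto
  define d where "d = a [^] l"
  have d: "d \<in> carrier R" and ad: "a \<otimes> d = c" and da: "d \<otimes> a = c"
    using a nat_pow_Suc2[OF a, of l] by (simp_all add: d_def c_def l)
  have ed: "e \<otimes> d = d \<otimes> e"
    using group_commutes_pow[of a e l] a e ea by (simp add: d_def)
  have u: "a \<otimes> e \<in> carrier R" using a e by simp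
  have "(a \<otimes> e \<oplus> f) \<otimes> (d \<otimes> s \<oplus> f) = \<one>"
    unfolding f_def
  proof (rule peirce_inverse[OF e ee u])
    show "a \<otimes> e \<otimes> e = a \<otimes> e" using a e ee by (simp add: m_assoc)
    show "d \<otimes> s \<in> carrier R" using d s by simp
    show *: "e \<otimes> (d \<otimes> s) = d \<otimes> s" using d s e es ed by (metis m_assoc)
    show "a \<otimes> e \<otimes> (d \<otimes> s) = e" using a d s e * ad cs by (metis m_assoc m_closed)
  qed
  moreover have "(s \<otimes> d \<oplus> f) \<otimes> (a \<otimes> e \<oplus> f) = \<one>"
    unfolding f_def
  proof (rule peirce_inverse[OF e ee])
    show "s \<otimes> d \<in> carrier R" using d s by simp
    show "s \<otimes> d \<otimes> e = s \<otimes> d" using d s e se ed by (metis m_assoc)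
    show "a \<otimes> e \<in> carrier R" by (rule u)
    show "e \<otimes> (a \<otimes> e) = a \<otimes> e" using a e 1 by (simp add: m_assoc)
    have "s \<otimes> d \<otimes> (a \<otimes> e) = s \<otimes> c \<otimes> e" using a d s e da by (metis m_assoc m_closed)
    then show "s \<otimes> d \<otimes> (a \<otimes> e) = e" by (simp add: sc ee)
  qed
  ultimately have "a \<otimes> e \<oplus> f \<in> Units R"
    using a d s e f(1) by (intro Units_of_inverses[of _ "s \<otimes> d \<oplus> f" "d \<otimes> s \<oplus> f"]) simp_all
  then show ?thesis using that e ee ea nil by (simp add: f_def)
qed

section \<open>Nilpotence of \<open>a - a\<^sup>n\<close>\<close>

text \<open>
  The hypothesis is used for \<open>a\<close> itself and for \<open>2\<close>. The latter makes a power of \<open>2 ^ Suc m - 2 > 0\<close> vanish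
  in \<open>R\<close>, so the kernel \<open>I\<close> of evaluation at \<open>a\<close> contains a positive integer; the former says that
  \<open>X ^ Suc m - X\<close> lies in the radical of \<open>I\<close>. Lifting \<open>X\<close> yields a polynomial whose value at \<open>a\<close> is the potent part.
\<close>

lemma potent_part_exists:
  assumes nil: "\<forall>a \<in> carrier R. a \<ominus> a [^] Suc m \<in> nilpotents R"
    and m: "m > 0" and a: "a \<in> carrier R"
  shows "\<exists>p \<in> potents R (Suc m). \<exists>b \<in> nilpotents R. a = p \<oplus> b \<and> p \<otimes> b = b \<otimes> p"
proof -
  define I where "I = {q. peval a q = \<zero>}"
  interpret comm_ideal I unfolding I_def using a by (rule comm_ideal_peval_kernel)
  have vanish: "\<exists>k. (q - q ^ Suc m) ^ k \<in> I" for q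
  proof -
    have "peval a q \<ominus> peval a q [^] Suc m \<in> nilpotents R"
      using nil a peval_closed by blast
    then have "peval a (q - q ^ Suc m) \<in> nilpotents R"
      using a by (simp only: peval_diff peval_power)
    then show ?thesis
      using a by (auto elim!: nilpotentsE simp: I_def peval_power)
  qed
  obtain k where k: "(2 - 2 ^ Suc m) ^ k \<in> I" using vanish by blast
  have "(2 :: nat) ^ 1 < 2 ^ Suc m" using m by (intro power_strict_increasing) auto
  then have pos: "(2 ^ Suc m - 2 :: nat) > 0" by simp
  then have "(of_nat (2 ^ Suc m - 2) :: int poly) = 2 ^ Suc m - 2"
    by (subst of_nat_diff) simp_all
  then have "(of_nat ((2 ^ Suc m - 2) ^ k) :: int poly) = (- 1 * (2 - 2 ^ Suc m)) ^ k"
    by (simp only: of_nat_power) simp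
  also have "\<dots> \<in> I" unfolding power_mult_distrib by (rule mult_mem[OF k])
  finally have N: "of_nat ((2 ^ Suc m - 2) ^ k) \<in> I" .
  obtain r where r: "([:0, 1:] - [:0, 1:] ^ Suc m) ^ r \<in> I" using vanish by blast
  have "([:0, 1:] ^ Suc m - [:0, 1:]) ^ r = (- 1 * ([:0, 1:] - [:0, 1:] ^ Suc m :: int poly)) ^ r"
    by simp
  also have "\<dots> \<in> I" unfolding power_mult_distrib by (rule mult_mem[OF r])
  finally have "[:0, 1:] ^ Suc m - [:0, 1:] \<in> radical" by (auto simp: radical_def)
  then obtain g where g: "g ^ Suc m - g \<in> I" "g - [:0, 1:] \<in> radical"
    using lift_potent[OF comm_ideal_axioms _ N m] pos by (auto simp del: power_Suc)
  define p where "p = peval a g"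
  have p: "p \<in> carrier R" using a by (simp add: p_def)
  have "p [^] Suc m \<ominus> p = \<zero>"
    using g(1) a by (simp only: p_def I_def mem_Collect_eq peval_diff peval_power)
  then have pp: "p [^] Suc m = p" using p by (simp del: nat_pow_Suc)
  obtain l where "(g - [:0, 1:]) ^ l \<in> I" using g(2) by (auto simp: radical_def)
  then have "(p \<ominus> a) [^] l = \<zero>"
    using a by (simp only: p_def I_def mem_Collect_eq peval_diff peval_power peval_X)
  then have "p \<ominus> a \<in> nilpotents R" using a p by (intro nilpotentsI) simp_all
  then have "\<ominus> (p \<ominus> a) \<in> nilpotents R" by (rule nilpotents_uminus)
  moreover have "\<ominus> (p \<ominus> a) = a \<ominus> p"
    using a p by (simp add: a_minus_def minus_add a_comm)
  ultimately have b: "a \<ominus> p \<in> nilpotents R" by simp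
  have "p \<otimes> a = a \<otimes> p" using a by (simp add: p_def peval_commutes)
  then have "p \<otimes> (a \<ominus> p) = (a \<ominus> p) \<otimes> p"
    using a p by (simp add: a_minus_def r_distr l_distr r_minus l_minus)
  moreover have "a = p \<oplus> (a \<ominus> p)"
    using a p by (simp add: a_minus_def a_lcomm[of p] r_neg)
  ultimately show ?thesis using p pp b unfolding potents_def by blast
qed

lemma power_strongly_nil_clean:
  assumes p: "p \<in> carrier R" "p [^] Suc m = p" and m: "m > 0"
    and b: "b \<in> nilpotents R" and pb: "p \<otimes> b = b \<otimes> p"
  shows "strongly_nil_clean_elt R ((p \<oplus> b) [^] m)"
proof -
  have bc: "b \<in> carrier R" using b by (rule nilpotents_closed)
  obtain c where c: "c \<in> carrier R" "b \<otimes> c = c \<otimes> b" "p \<otimes> c = c \<otimes> p"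
    "(p \<oplus> b) [^] m = p [^] m \<oplus> b \<otimes> c"
    by (rule power_add_commuting[OF p(1) bc pb])
  have "p \<otimes> (b \<otimes> c) = (b \<otimes> c) \<otimes> p"
    using p(1) bc c(1,3) pb by (metis m_assoc)
  then have "p [^] m \<otimes> (b \<otimes> c) = (b \<otimes> c) \<otimes> p [^] m"
    using group_commutes_pow[of p "b \<otimes> c" m] p(1) bc c(1) by simp
  moreover have "b \<otimes> c \<in> nilpotents R" using b c(1,2) by (rule nilpotents_mult)
  moreover have "p [^] m \<in> idempotents R"
    using p potent_power_idempotent[OF p m] by (simp add: idempotents_def)
  ultimately show ?thesis
    unfolding strongly_nil_clean_elt_def using c(4) by blast
qed

text \<open>
  If \<open>a ^ m = e + b\<close>, then \<open>a ^ m (1 - a ^ m)\<close> is a multiple of \<open>b\<close>, hence nilpotent; it divides the \<open>m\<close>-th power of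
  \<open>a (1 - a ^ m)\<close>.
\<close>

lemma nilpotent_diff_of_strongly_nil_clean_power:
  assumes a: "a \<in> carrier R" and m: "m > 0" and clean: "strongly_nil_clean_elt R (a [^] m)"
  shows "a \<ominus> a [^] Suc m \<in> nilpotents R"
proof -
  obtain e b where "e \<in> idempotents R" and b: "b \<in> nilpotents R"
    and ab: "a [^] m = e \<oplus> b" and eb: "e \<otimes> b = b \<otimes> e"
    using clean by (auto simp: strongly_nil_clean_elt_def)
  then have e: "e \<in> carrier R" "e \<otimes> e = e" by (auto simp: idempotents_def)
  have bc: "b \<in> carrier R" using b by (rule nilpotents_closed)
  define f where "f = \<one> \<ominus> e"
  note f = complement_idempotent[OF e, folded f_def]
  have fb: "f \<otimes> b = b \<otimes> f"
    using e(1) bc eb by (simp add: f_def a_minus_def r_distr l_distr r_minus l_minus)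
  have "\<one> \<ominus> a [^] m = f \<ominus> b"
    using e(1) bc by (simp add: ab f_def a_minus_def minus_add a_assoc)
  moreover have "(e \<oplus> b) \<otimes> (f \<ominus> b) = b \<otimes> (f \<ominus> (e \<oplus> b))"
    using e(1) bc f by (simp add: a_minus_def r_distr l_distr r_minus minus_add eb a_ac)
  ultimately have "a [^] m \<otimes> (\<one> \<ominus> a [^] m) = b \<otimes> (f \<ominus> (e \<oplus> b))"
    by (simp add: ab)
  moreover have "b \<otimes> (f \<ominus> (e \<oplus> b)) \<in> nilpotents R"
    using e(1) bc f(1)
    by (intro nilpotents_mult[OF b])
      (simp_all add: a_minus_def r_distr l_distr r_minus l_minus minus_add eb fb)
  ultimately have n: "a [^] m \<otimes> (\<one> \<ominus> a [^] m) \<in> nilpotents R" by simp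
  define y where "y = \<one> \<ominus> a [^] m"
  have y: "y \<in> carrier R" "a \<otimes> y = y \<otimes> a"
    using a nat_pow_Suc2[OF a, of m]
    by (simp_all add: y_def a_minus_def r_distr l_distr r_minus l_minus)
  have z: "a \<ominus> a [^] Suc m = a \<otimes> y"
    using a nat_pow_Suc2[OF a, of m] by (simp add: y_def a_minus_def r_distr r_minus)
  obtain l where l: "m = Suc l" using m by (cases m) auto
  have ayk: "a [^] m \<otimes> y = y \<otimes> a [^] m"
    using group_commutes_pow[OF y(2) a y(1), of m] .
  have yl: "y [^] l \<otimes> a [^] m = a [^] m \<otimes> y [^] l"
    using group_commutes_pow[of y "a [^] m" l] ayk a y(1) by simp
  have "(a \<otimes> y) [^] m = a [^] m \<otimes> y \<otimes> y [^] l"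
    using pow_mult_distrib[OF y(2) a y(1), of m] a y(1) nat_pow_Suc2[OF y(1), of l]
    by (simp add: l m_assoc del: nat_pow_Suc)
  moreover have "a [^] m \<otimes> y \<otimes> y [^] l \<in> nilpotents R"
  proof (rule nilpotents_mult[OF n[folded y_def]])
    show "y [^] l \<in> carrier R" using y by simp
    have "y [^] l \<otimes> (a [^] m \<otimes> y) = a [^] m \<otimes> (y [^] l \<otimes> y)"
      using a y(1) yl by (simp flip: m_assoc)
    also have "y [^] l \<otimes> y = y \<otimes> y [^] l" using nat_pow_Suc2[OF y(1), of l] by simp
    finally show "a [^] m \<otimes> y \<otimes> y [^] l = y [^] l \<otimes> (a [^] m \<otimes> y)"
      using a y(1) by (simp add: m_assoc)
  qed
  ultimately have "(a \<otimes> y) [^] m \<in> nilpotents R" by simp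
  then show ?thesis unfolding z by (rule nilpotents_power[OF _ m_closed[OF a y(1)]])
qed

text \<open>
  Expanding \<open>(X - X ^ Suc m) ^ k = X ^ k (1 - X ^ m) ^ k\<close> around \<open>X = 0\<close> gives \<open>X ^ k - X ^ (k + 1) g\<close>, and
  evaluation at \<open>a\<close> makes \<open>g\<close> commute with \<open>a\<close>.
\<close>

lemma pi_regular_of_nilpotent_diff:
  assumes a: "a \<in> carrier R" and nil: "a \<ominus> a [^] Suc m \<in> nilpotents R" and m: "m > 0"
  shows "\<exists>k::nat. k > 0 \<and> a [^] k \<in> (a [^] (k + 1) <# carrier R) \<inter> (carrier R #> a [^] (k + 1))"
proof -
  obtain k :: nat where k: "k > 0" "(a \<ominus> a [^] Suc m) [^] k = \<zero>"
    using nil by (rule nilpotentsE)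
  let ?X = "[:0, 1:] :: int poly"
  have "1 - (1 - ?X ^ m) ^ k = (1 - (1 - ?X ^ m)) * (\<Sum>i<k. (1 - ?X ^ m) ^ i)"
    by (rule one_diff_power_eq)
  then have "?X dvd 1 - (1 - ?X ^ m) ^ k"
    using m dvd_power[of m ?X] by (simp add: dvd_mult2)
  then obtain g where g: "1 - (1 - ?X ^ m) ^ k = ?X * g" by (rule dvdE)
  have "(?X - ?X ^ Suc m) ^ k = ?X ^ k * (1 - ?X ^ m) ^ k"
    unfolding power_mult_distrib[symmetric] by (simp add: right_diff_distrib)
  also have "(1 - ?X ^ m) ^ k = 1 - ?X * g" using g by (simp add: algebra_simps)
  also have "?X ^ k * (1 - ?X * g) = ?X ^ k - ?X ^ (k + 1) * g"
    by (simp add: algebra_simps)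
  finally have eq: "(?X - ?X ^ Suc m) ^ k = ?X ^ k - ?X ^ (k + 1) * g" .
  have "\<zero> = peval a ((?X - ?X ^ Suc m) ^ k)"
    using a k(2) by (simp only: peval_power peval_diff peval_X)
  then have "a [^] k \<ominus> a [^] (k + 1) \<otimes> peval a g = \<zero>"
    unfolding eq using a by (simp only: peval_diff peval_mult peval_power peval_X)
  then have 1: "a [^] k = a [^] (k + 1) \<otimes> peval a g" using a by (simp del: nat_pow_Suc)
  have "a [^] (k + 1) \<otimes> peval a g = peval a (?X ^ (k + 1) * g)"
    using a by (simp only: peval_mult peval_power peval_X)
  also have "\<dots> = peval a g \<otimes> a [^] (k + 1)"
    unfolding mult.commute[of _ g] using a by (simp only: peval_mult peval_power peval_X)
  finally have "a [^] (k + 1) \<otimes> peval a g = peval a g \<otimes> a [^] (k + 1)" .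
  with 1 have 2: "a [^] k = peval a g \<otimes> a [^] (k + 1)" by (rule trans)
  have "peval a g \<in> carrier R" using a by simp
  with 1 2 k(1) show ?thesis unfolding l_coset_def r_coset_def by blast
qed

lemma one_minus_power_nilpotent:
  assumes u: "u \<in> Units R" and nil: "u \<ominus> u [^] Suc m \<in> nilpotents R"
  shows "\<one> \<ominus> u [^] m \<in> nilpotents R"
proof -
  have uc: "u \<in> carrier R" using u by blast
  have 1: "u \<ominus> u [^] Suc m = u \<otimes> (\<one> \<ominus> u [^] m)"
    using uc nat_pow_Suc2[OF uc, of m] by (simp add: a_minus_def r_distr r_minus)
  have 2: "u \<ominus> u [^] Suc m = (\<one> \<ominus> u [^] m) \<otimes> u"
    using uc by (simp add: a_minus_def l_distr l_minus)
  have "(u \<ominus> u [^] Suc m) \<otimes> inv u = \<one> \<ominus> u [^] m"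
    unfolding 2 using u uc by (simp add: m_assoc)
  moreover have "inv u \<otimes> (u \<ominus> u [^] Suc m) = \<one> \<ominus> u [^] m"
    unfolding 1 using u uc by (simp flip: m_assoc)
  ultimately show ?thesis using nilpotents_mult[OF nil, of "inv u"] u by simp
qed

text \<open>
  Fitting's idempotent \<open>e\<close> is used to check nilpotence on the two Peirce components of \<open>a - a ^ Suc m\<close>. On the
  corner of \<open>1 - e\<close> the element \<open>a\<close> itself is nilpotent. On that of \<open>e\<close> it agrees with a unit \<open>u\<close> of \<open>R\<close>, and
  \<open>u ^ m = 1 + q\<close> with \<open>q\<close> nilpotent turns the component into \<open>- q a e\<close>.
\<close>

lemma nilpotent_diff_of_pi_regular_UU:
  assumes reg: "strongly_pi_regular R" and UU: "UU_ring m R" and m: "m > 0"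
    and a: "a \<in> carrier R"
  shows "a \<ominus> a [^] Suc m \<in> nilpotents R"
proof -
  obtain k :: nat where "k > 0"
    "a [^] k \<in> (a [^] (k + 1) <# carrier R) \<inter> (carrier R #> a [^] (k + 1))"
    using reg a unfolding strongly_pi_regular_def by blast
  then obtain e where e: "e \<in> carrier R" "e \<otimes> e = e" "e \<otimes> a = a \<otimes> e"
    and fa: "(\<one> \<ominus> e) \<otimes> a \<in> nilpotents R" and u: "a \<otimes> e \<oplus> (\<one> \<ominus> e) \<in> Units R"
    using fitting_idempotent[OF a] by blast
  define f where "f = \<one> \<ominus> e"
  note f = complement_idempotent[OF e(1,2), folded f_def]
  define u where "u = a \<otimes> e \<oplus> f"
  have uU: "u \<in> Units R" using assms u by (simp add: u_def f_def)
  have uc: "u \<in> carrier R" using uU by blast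
  obtain q where q: "q \<in> nilpotents R" "u [^] m = \<one> \<oplus> q"
    using UU uU by (auto simp: UU_ring_def a_l_coset_def')
  have qc: "q \<in> carrier R" using q(1) by (rule nilpotents_closed)
  have fa': "f \<otimes> a = a \<otimes> f"
    using a e by (simp add: f_def a_minus_def l_distr r_distr l_minus r_minus)
  have ae: "a \<otimes> e \<otimes> e = a \<otimes> e" using a e by (simp add: m_assoc)
  have eae: "e \<otimes> (a \<otimes> e) = a \<otimes> e" using a e ae by (simp flip: m_assoc)
  have eu: "e \<otimes> u = a \<otimes> e" and ue: "u \<otimes> e = a \<otimes> e"
    using a e(1) f eae ae by (simp_all add: u_def r_distr l_distr)
  have "q = u [^] m \<ominus> \<one>" using qc q(2) by (simp add: a_minus_def a_ac r_neg)
  then have uq: "u \<otimes> q = q \<otimes> u"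
    using uc nat_pow_Suc2[OF uc, of m]
    by (simp add: a_minus_def r_distr l_distr r_minus l_minus)
  have "u [^] m \<otimes> e = e \<otimes> u [^] m"
    using group_commutes_pow[of u e m] uc e(1) eu ue by simp
  then have eq: "q \<otimes> e = e \<otimes> q"
    using e(1) qc by (simp add: q(2) l_distr r_distr)
  have "e \<otimes> u [^] m = (e \<otimes> u) [^] m"
    using pow_mult_distrib[of e u m] e uc eu ue m idempotent_power[OF e(2,1) m] by simp
  also have "\<dots> = e \<otimes> a [^] m"
    unfolding eu e(3)[symmetric]
    using pow_mult_distrib[of e a m] e a idempotent_power[OF e(2,1) m] by simp
  finally have am: "e \<otimes> a [^] m = e \<oplus> e \<otimes> q"
    using e(1) qc by (simp add: q(2) r_distr)
  have z: "a \<ominus> a [^] Suc m = a \<otimes> (\<one> \<ominus> a [^] m)"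
    using a nat_pow_Suc2[OF a, of m] by (simp add: a_minus_def r_distr r_minus)
  have "e \<otimes> (\<one> \<ominus> a [^] m) = \<ominus> (e \<otimes> q)"
    using e(1) a qc by (simp add: a_minus_def r_distr r_minus am minus_add r_neg1 r_neg2)
  then have "e \<otimes> (a \<ominus> a [^] Suc m) = \<ominus> (q \<otimes> (a \<otimes> e))"
  proof -
    have "e \<otimes> (a \<ominus> a [^] Suc m) = a \<otimes> (e \<otimes> (\<one> \<ominus> a [^] m))"
      unfolding z using a e by (simp flip: m_assoc)
    also have "\<dots> = \<ominus> (a \<otimes> e \<otimes> q)"
      unfolding \<open>e \<otimes> (\<one> \<ominus> a [^] m) = \<ominus> (e \<otimes> q)\<close> using a e(1) qc by (simp add: r_minus m_assoc)
    also have "a \<otimes> e \<otimes> q = q \<otimes> (a \<otimes> e)"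
      using uc e(1) qc by (simp add: ue[symmetric] m_assoc eq[symmetric]) (simp add: uq flip: m_assoc)
    finally show ?thesis .
  qed
  moreover have "q \<otimes> (a \<otimes> e) \<in> nilpotents R"
  proof (rule nilpotents_mult[OF q(1)])
    show "a \<otimes> e \<in> carrier R" using a e by simp
    show "q \<otimes> (a \<otimes> e) = a \<otimes> e \<otimes> q"
      using uc e(1) qc by (simp add: ue[symmetric] m_assoc eq[symmetric]) (simp add: uq flip: m_assoc)
  qed
  ultimately have n1: "e \<otimes> (a \<ominus> a [^] Suc m) \<in> nilpotents R"
    by (simp only: nilpotents_uminus)
  define y where "y = \<one> \<ominus> a [^] m"
  have y: "y \<in> carrier R" "a \<otimes> y = y \<otimes> a"
    using a nat_pow_Suc2[OF a, of m]
    by (simp_all add: y_def a_minus_def r_distr l_distr r_minus l_minus)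
  have "a [^] m \<otimes> f = f \<otimes> a [^] m"
    using group_commutes_pow[of a f m] fa' a f(1) by simp
  then have fy: "f \<otimes> y = y \<otimes> f"
    using a f(1) by (simp add: y_def a_minus_def r_distr l_distr r_minus l_minus)
  have "f \<otimes> a \<otimes> y \<in> nilpotents R"
    using fa[folded f_def] y(1)
  proof (rule nilpotents_mult)
    have "f \<otimes> a \<otimes> y = f \<otimes> y \<otimes> a" using a f(1) y by (simp add: m_assoc)
    also have "\<dots> = y \<otimes> (f \<otimes> a)" using a f(1) y(1) by (simp add: fy m_assoc)
    finally show "f \<otimes> a \<otimes> y = y \<otimes> (f \<otimes> a)" .
  qed
  then have n2: "(\<one> \<ominus> e) \<otimes> (a \<ominus> a [^] Suc m) \<in> nilpotents R"
    using a f(1) y(1) unfolding z y_def[symmetric] f_def[symmetric] by (simp add: m_assoc)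
  have "a [^] m \<otimes> e = e \<otimes> a [^] m"
    using group_commutes_pow[of a e m] a e by simp
  moreover have "a [^] Suc m \<otimes> e = e \<otimes> a [^] Suc m"
    using group_commutes_pow[of a e "Suc m"] a e by (simp del: nat_pow_Suc)
  ultimately have "e \<otimes> (a \<ominus> a [^] Suc m) = (a \<ominus> a [^] Suc m) \<otimes> e"
    using a e by (simp add: a_minus_def r_distr l_distr r_minus l_minus del: nat_pow_Suc)
  then show ?thesis
    using a by (intro nilpotents_peirce[OF e(1,2) _ _ n1 n2]) simp_all
qed

end

theorem theorem2p8:
  fixes R (structure) and n :: nat
  assumes "ring R" and "n \<ge> 2"
  defines "cond1 \<equiv> strongly_n_nil_clean R n"
    and "cond2 \<equiv> \<forall>a \<in> carrier R. \<exists>e \<in> idempotents R. \<exists>v \<in> Units R. \<exists>b \<in> nilpotents R.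
           v [^] n = v \<and> a = e \<otimes> v \<oplus> b \<and> a \<otimes> b = b \<otimes> a \<and> e \<otimes> v = v \<otimes> e"
    and "cond3 \<equiv> \<forall>a \<in> carrier R. \<exists>e \<in> idempotents R. \<exists>v \<in> Units R. \<exists>b \<in> nilpotents R.
           v [^] n = v \<and> a = e \<otimes> v \<oplus> b \<and> a \<otimes> b = b \<otimes> a \<and> v \<otimes> e = e \<otimes> v \<otimes> e"
    and "cond4 \<equiv> \<forall>a \<in> carrier R. a \<ominus> a [^] n \<in> nilpotents R"
    and "cond5 \<equiv> \<forall>a \<in> carrier R. strongly_nil_clean_elt R (a [^] (n - 1))"
    and "cond6 \<equiv> strongly_pi_regular R \<and> UU_ring (n - 1) R"
  shows "(cond1 \<longleftrightarrow> cond2) \<and> (cond1 \<longleftrightarrow> cond3) \<and> (cond1 \<longleftrightarrow> cond4) \<and>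
         (cond1 \<longleftrightarrow> cond5) \<and> (cond1 \<longleftrightarrow> cond6)"
proof -
  interpret ring R by fact
  obtain m where n: "n = Suc m" and m: "m > 0"
    using assms(2) by (cases n) auto
  have 12: cond2 if hyp: cond1
    unfolding cond2_def
  proof
    fix a assume "a \<in> carrier R"
    then obtain p b where p: "p \<in> carrier R" "p [^] Suc m = p" and b: "b \<in> nilpotents R"
      and a: "a = p \<oplus> b" "p \<otimes> b = b \<otimes> p"
      using hyp by (auto simp: cond1_def strongly_n_nil_clean_def potents_def n)
    obtain e v where ev: "e \<in> idempotents R" "v \<in> Units R" "v [^] Suc m = v"
      "p = e \<otimes> v" "e \<otimes> v = v \<otimes> e"
      using potent_eq_idempotent_times_unit[OF p m] .
    have "a \<otimes> b = b \<otimes> a"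
      using p b a by (simp add: l_distr r_distr nilpotents_closed)
    with ev a(1) b show "\<exists>e \<in> idempotents R. \<exists>v \<in> Units R. \<exists>b \<in> nilpotents R.
        v [^] n = v \<and> a = e \<otimes> v \<oplus> b \<and> a \<otimes> b = b \<otimes> a \<and> e \<otimes> v = v \<otimes> e"
      unfolding n by blast
  qed
  have "v \<otimes> e = e \<otimes> v \<otimes> e" if "e \<in> idempotents R" "v \<in> Units R" "e \<otimes> v = v \<otimes> e" for e v
  proof -
    have "e \<otimes> v \<otimes> e = v \<otimes> (e \<otimes> e)" using that by (simp add: idempotents_def m_assoc Units_closed)
    then show ?thesis using that by (simp add: idempotents_def)
  qed
  then have 23: cond3 if cond2
    using that unfolding cond2_def cond3_def by meson
  have 31: cond1 if hyp: cond3
    unfolding cond1_def strongly_n_nil_clean_def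
  proof
    fix a assume "a \<in> carrier R"
    then obtain e v b where "e \<in> idempotents R" and v: "v \<in> Units R" "v [^] Suc m = v"
      and b: "b \<in> nilpotents R" and a: "a = e \<otimes> v \<oplus> b" "a \<otimes> b = b \<otimes> a"
      and ve: "v \<otimes> e = e \<otimes> v \<otimes> e"
      using hyp unfolding cond3_def n by blast
    then have e: "e \<in> carrier R" "e \<otimes> e = e" by (auto simp: idempotents_def)
    have ev: "e \<otimes> v \<in> carrier R" using e v(1) by (simp add: Units_closed)
    have bc: "b \<in> carrier R" using b by (rule nilpotents_closed)
    have "e \<otimes> v \<in> potents R n"
      using ev idempotent_times_potent_unit[OF e v ve] by (simp only: potents_def n mem_Collect_eq)
    moreover have "(e \<otimes> v) \<otimes> b \<oplus> b \<otimes> b = b \<otimes> (e \<otimes> v) \<oplus> b \<otimes> b"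
      using a(2) ev bc unfolding a(1) by (simp only: l_distr r_distr)
    then have "(e \<otimes> v) \<otimes> b = b \<otimes> (e \<otimes> v)" using ev bc by simp
    ultimately show "\<exists>p \<in> potents R n. \<exists>b \<in> nilpotents R. a = p \<oplus> b \<and> p \<otimes> b = b \<otimes> p"
      using a(1) b by blast
  qed
  have 15: cond5 if hyp: cond1
    unfolding cond5_def
  proof
    fix a assume "a \<in> carrier R"
    then obtain p b where "p \<in> carrier R" "p [^] Suc m = p" "b \<in> nilpotents R"
      "a = p \<oplus> b" "p \<otimes> b = b \<otimes> p"
      using hyp by (auto simp: cond1_def strongly_n_nil_clean_def potents_def n)
    then show "strongly_nil_clean_elt R (a [^] (n - 1))"
      using power_strongly_nil_clean m by (simp add: n del: nat_pow_Suc)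
  qed
  have 54: cond4 if cond5
    using that nilpotent_diff_of_strongly_nil_clean_power m
    unfolding cond5_def cond4_def n diff_Suc_1 by blast
  have 41: cond1 if cond4
    using that potent_part_exists m
    unfolding cond4_def cond1_def strongly_n_nil_clean_def n by blast
  have 46: cond6 if cond4
  proof -
    have nil: "a \<ominus> a [^] Suc m \<in> nilpotents R" if "a \<in> carrier R" for a
      using \<open>cond4\<close> that unfolding cond4_def n by blast
    have "strongly_pi_regular R"
      unfolding strongly_pi_regular_def using pi_regular_of_nilpotent_diff nil m by blast
    moreover have "UU_ring m R"
      unfolding UU_ring_def
    proof
      fix u assume u: "u \<in> Units R"
      then have uc: "u \<in> carrier R" by blast
      have "\<ominus> (\<one> \<ominus> u [^] m) \<in> nilpotents R"
        using one_minus_power_nilpotent[OF u nil[OF uc]] by (rule nilpotents_uminus)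
      moreover have "u [^] m = \<one> \<oplus> \<ominus> (\<one> \<ominus> u [^] m)"
        using uc by (simp add: a_minus_def minus_add r_neg1 r_neg2)
      ultimately show "u [^] m \<in> \<one> <+ nilpotents R"
        by (auto simp only: a_l_coset_def')
    qed
    ultimately show ?thesis by (simp add: cond6_def n)
  qed
  have 64: cond4 if cond6
    using that nilpotent_diff_of_pi_regular_UU m
    unfolding cond4_def cond6_def n diff_Suc_1 by blast
  show ?thesis using 12 23 31 15 54 41 46 64 by blast
qed

end
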